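(* Let $A_n := |P(S, n\times n)|$ be the number of distinct $n\times n$ patterns occurring in the 2-dimensional paperfolding structure $S$ (defined in the context). Then $A_1=4$, $A_2=68$, and for every integer $n\geq 3$, \[ A_n = 12 n^2 + 24\, n\, 2^{\alpha} - 16\cdot 4^{\alpha} - 4, \qquad \text{where } \alpha=\lfloor \log_2(n-1)\rfloor. \]
   Context: Let $\mathcal{A}=\{\mathtt{A},\mathtt{B},\dots,\mathtt{P}\}$ (16 letters) and $\mathcal{B}=\{\mathtt{0},\mathtt{1},\mathtt{2},\mathtt{3}\}$. A letter-to-block map assigns to each letter a $2\times 2$ matrix; we write a block as $(w\,x / y\,z)$ meaning first row $w\,x$, second row $y\,z$. The substitution $\mu$ on $\mathcal{A}$ is: $\mathtt{A}\mapsto(\mathtt{A\,F}/\mathtt{G\,C})$, $\mathtt{B}\mapsto(\mathtt{A\,F}/\mathtt{H\,D})$, $\mathtt{C}\mapsto(\mathtt{B\,E}/\mathtt{G\,C})$, $\mathtt{D}\mapsto(\mathtt{B\,E}/\mathtt{H\,D})$, $\mathtt{E}\mapsto(\mathtt{A\,N}/\mathtt{G\,K})$, $\mathtt{F}\mapsto(\mathtt{A\,N}/\mathtt{H\,L})$, $\mathtt{G}\mapsto(\mathtt{B\,M}/\mathtt{G\,K})$, $\mathtt{H}\mapsto(\mathtt{B\,M}/\mathtt{H\,L})$, $\mathtt{I}\mapsto(\mathtt{I\,F}/\mathtt{O\,C})$, $\mathtt{J}\mapsto(\mathtt{I\,F}/\mathtt{P\,D})$, $\mathtt{K}\mapsto(\mathtt{J\,E}/\mathtt{O\,C})$,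 $\mathtt{L}\mapsto(\mathtt{J\,E}/\mathtt{P\,D})$, $\mathtt{M}\mapsto(\mathtt{I\,N}/\mathtt{O\,K})$, $\mathtt{N}\mapsto(\mathtt{I\,N}/\mathtt{P\,L})$, $\mathtt{O}\mapsto(\mathtt{J\,M}/\mathtt{O\,K})$, $\mathtt{P}\mapsto(\mathtt{J\,M}/\mathtt{P\,L})$. The map $\phi$ from $\mathcal{A}$ to $2\times2$ blocks over $\mathcal{B}$ is: $\mathtt{A}\mapsto(01/00)$, $\mathtt{B}\mapsto(01/11)$, $\mathtt{C}\mapsto(10/00)$, $\mathtt{D}\mapsto(10/11)$, $\mathtt{E}\mapsto(03/02)$, $\mathtt{F}\mapsto(03/13)$, $\mathtt{G}\mapsto(12/02)$, $\mathtt{H}\mapsto(12/13)$, $\mathtt{I}\mapsto(21/20)$, $\mathtt{J}\mapsto(21/31)$, $\mathtt{K}\mapsto(30/20)$, $\mathtt{L}\mapsto(30/31)$, $\mathtt{M}\mapsto(23/22)$, $\mathtt{N}\mapsto(23/33)$, $\mathtt{O}\mapsto(32/22)$, $\mathtt{P}\mapsto(32/33)$. For an $m\times n$ matrix $X$ over $\mathcal{A}$, $\mu(X)$ (resp. $\phi(X)$) is the $2m\times 2n$ matrix obtained by replacing each entry $X_{r,c}$ by the block $\mu(X_{r,c})$ (resp. $\phi(X_{r,c})$) in rows $2r-1,2r$ and columns $2c-1,2c$; $\mu^0$ is the identity and $\mu^k=\mu^{k-1}\circ\mu$. Set $T_k:=\mu^k(\mathtt{N})$ ($2^k\times 2^k$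 matrix). A pattern of a matrix $X$ is a contiguous submatrix; $P(X,m\times n)$ is the set of all $m\times n$ contiguous submatrices of $X$. For the limit structures put $P(T,m\times n):=\bigcup_{k\ge0}P(T_k,m\times n)$ and $P(S,m\times n):=\bigcup_{k\ge0}P(\phi(T_k),m\times n)$ (here $T_k$ is the upper-right $2^k\times2^k$ block of $T_{k+1}$, and $\phi(T_k)$, after decorating each symbol of $\mathcal{B}$ with a pair of mountain/valley creases, is the upper-right quadrant of the crease pattern obtained by folding a square paper $k+1$ times alternately in the two axis directions). *)

theory Defs
  imports Complex_Main "Jordan_Normal_Form.Matrix"
begin

datatype letter =
  LA | LB | LC | LD | LE | LF | LG | LH | LI | LJ | LK | LL | LM | LN | LO | LP

datatype digit = D0 | D1 | D2 | D3

text \<open>The block written \<open>(w x / y z)\<close>: first row \<open>w x\<close>, second row \<open>y z\<close>.\<close>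

definition block :: "'a \<Rightarrow> 'a \<Rightarrow> 'a \<Rightarrow> 'a \<Rightarrow> 'a mat" where
  "block w x y z = mat_of_rows_list 2 [[w, x], [y, z]]"

fun mu :: "letter \<Rightarrow> letter mat" where
  "mu LA = block LA LF LG LC"
| "mu LB = block LA LF LH LD"
| "mu LC = block LB LE LG LC"
| "mu LD = block LB LE LH LD"
| "mu LE = block LA LN LG LK"
| "mu LF = block LA LN LH LL"
| "mu LG = block LB LM LG LK"
| "mu LH = block LB LM LH LL"
| "mu LI = block LI LF LO LC"
| "mu LJ = block LI LF LP LD"
| "mu LK = block LJ LE LO LC"
| "mu LL = block LJ LE LP LD"
| "mu LM = block LI LN LO LK"
| "mu LN = block LI LN LP LL"
| "mu LO = block LJ LM LO LK"
| "mu LP = block LJ LM LP LL"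

fun phi :: "letter \<Rightarrow> digit mat" where
  "phi LA = block D0 D1 D0 D0"
| "phi LB = block D0 D1 D1 D1"
| "phi LC = block D1 D0 D0 D0"
| "phi LD = block D1 D0 D1 D1"
| "phi LE = block D0 D3 D0 D2"
| "phi LF = block D0 D3 D1 D3"
| "phi LG = block D1 D2 D0 D2"
| "phi LH = block D1 D2 D1 D3"
| "phi LI = block D2 D1 D2 D0"
| "phi LJ = block D2 D1 D3 D1"
| "phi LK = block D3 D0 D2 D0"
| "phi LL = block D3 D0 D3 D1"
| "phi LM = block D2 D3 D2 D2"
| "phi LN = block D2 D3 D3 D3"
| "phi LO = block D3 D2 D2 D2"
| "phi LP = block D3 D2 D3 D3"

text \<open>
  Matrix indices start at 0, so the block replacing the entry at \<open>(r, c)\<close> occupies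
  rows \<open>2r\<close>, \<open>2r + 1\<close> and columns \<open>2c\<close>, \<open>2c + 1\<close>.
\<close>

definition apply_blocks :: "('a \<Rightarrow> 'b mat) \<Rightarrow> 'a mat \<Rightarrow> 'b mat" where
  "apply_blocks f X = mat (2 * dim_row X) (2 * dim_col X)
     (\<lambda>(i, j). f (X $$ (i div 2, j div 2)) $$ (i mod 2, j mod 2))"

definition T :: "nat \<Rightarrow> letter mat" where
  "T k = (apply_blocks mu ^^ k) (mat 1 1 (\<lambda>_. LN))"

definition patterns :: "'a mat \<Rightarrow> nat \<Rightarrow> nat \<Rightarrow> 'a mat set" where
  "patterns X m n = {mat m n (\<lambda>(i, j). X $$ (r + i, c + j)) | r c.
     r + m \<le> dim_row X \<and> c + n \<le> dim_col X}"

definition S_patterns :: "nat \<Rightarrow> nat \<Rightarrow> digit mat set" where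
  "S_patterns m n = (\<Union>k. patterns (apply_blocks phi (T k)) m n)"

end

theory Submission
  imports Defs "HOL-Number_Theory.Cong"
begin

text \<open>
  A digit of \<open>S\<close> is a pair of bits. Writing the column as \<open>j = 2^t (2m + 1)\<close> and the row as
  \<open>i = 2^s (2l + 1) - 1\<close>, these bits are the parities of \<open>m + i div 2^(t+1)\<close> and of
  \<open>l + j div 2^s\<close>: a column of valuation \<open>t\<close> is a square wave
  with runs of length \<open>2^(t+1)\<close>, a row a square wave with runs of length \<open>2^s\<close>.

  Let \<open>2^\<alpha> < n \<le> M = 2^(\<alpha>+1)\<close>. For \<open>n \<ge> 3\<close> an \<open>n\<times>n\<close> window determines its position modulo \<open>M\<close>, one
  bit after the other. Given these residues, all columns of valuation below \<open>\<alpha>\<close> and the corresponding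
  rows are known; the rest of the window depends on at most one column and row of valuation exactly
  \<open>\<alpha>\<close>, and at most one of higher valuation. The data carried by these lines at a vertex of the
  \<open>M\<close>-grid take 20 values. How many of them the window can distinguish depends only on which of the four
  lines, and which crossing, it sees; summing over the \<open>M^2\<close> residues gives the formula.
\<close>

section \<open>Crease bits\<close>

text \<open>The value at \<open>j = 0\<close> is arbitrary: this column is never reached from \<open>T\<close>.\<close>

fun hbit :: "nat \<Rightarrow> nat \<Rightarrow> bool" where
  "hbit i j = (if j = 0 then True else if odd j then odd (i div 2 + j div 2)
    else hbit (i div 2) (j div 2))"

function vbit :: "nat \<Rightarrow> nat \<Rightarrow> bool" where
  "vbit i j = (if even i then odd (i div 2) \<noteq> odd j else vbit (i div 2) (j div 2))"
  by pat_completeness auto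
termination by (relation "measure fst") (auto elim: oddE)

declare hbit.simps [simp del] vbit.simps [simp del]

definition dig :: "bool \<Rightarrow> bool \<Rightarrow> digit" where
  "dig h v = (if h then if v then D3 else D2 else if v then D1 else D0)"

lemma dig_inject [simp]: "dig h v = dig h' v' \<longleftrightarrow> h = h' \<and> v = v'"
  by (auto simp: dig_def)

section \<open>Letters as bit strings and the substitution in bits\<close>

text \<open>The arguments are the binary digits of the index of the letter, most significant first.\<close>

fun letter_of :: "bool \<Rightarrow> bool \<Rightarrow> bool \<Rightarrow> bool \<Rightarrow> letter" where
  "letter_of False False False False = LA"
| "letter_of False False False True = LB"
| "letter_of False False True False = LC"
| "letter_of False False True True = LD"
| "letter_of False True False False = LE"
| "letter_of False True False True = LF"
| "letter_of False True True False = LG"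
| "letter_of False True True True = LH"
| "letter_of True False False False = LI"
| "letter_of True False False True = LJ"
| "letter_of True False True False = LK"
| "letter_of True False True True = LL"
| "letter_of True True False False = LM"
| "letter_of True True False True = LN"
| "letter_of True True True False = LO"
| "letter_of True True True True = LP"

text \<open>In binary the sixteen rules become one: every bit of a child letter is a constant or a
  bit of the parent, possibly negated.\<close>

lemma mu_letter_of:
  "mu (letter_of a b c d) = block (letter_of a False False c) (letter_of b True False (\<not> c))
     (letter_of a True True d) (letter_of b False True d)"
  by (cases a; cases b; cases c; cases d) simp_all

lemma phi_letter_of:
  "phi (letter_of a b c d) = block (dig a c) (dig b (\<not> c)) (dig a d) (dig b d)"
  by (cases a; cases b; cases c; cases d) (simp_all add: dig_def)

section \<open>Entries of the matrices, and patterns as windows\<close>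

lemma index_block:
  assumes "p < 2" "q < 2"
  shows "block w x y z $$ (p, q) = (if p = 0 then if q = 0 then w else x else if q = 0 then y else z)"
  using assms by (auto simp: block_def mat_of_rows_list_def less_2_cases_iff)

lemma dim_apply_blocks [simp]:
  "dim_row (apply_blocks f X) = 2 * dim_row X" "dim_col (apply_blocks f X) = 2 * dim_col X"
  by (simp_all add: apply_blocks_def)

lemma index_apply_blocks:
  "i < 2 * dim_row X \<Longrightarrow> j < 2 * dim_col X \<Longrightarrow>
    apply_blocks f X $$ (i, j) = f (X $$ (i div 2, j div 2)) $$ (i mod 2, j mod 2)"
  by (simp add: apply_blocks_def)

lemma T_Suc: "T (Suc k) = apply_blocks mu (T k)"
  by (simp add: T_def)

lemma dim_T [simp]: "dim_row (T k) = 2 ^ k" "dim_col (T k) = 2 ^ k"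
  by (induction k) (simp_all add: T_Suc, simp_all add: T_def)

lemma hbit_rec: "j > 0 \<Longrightarrow> hbit i j = (if odd j then odd (i div 2 + j div 2) else hbit (i div 2) (j div 2))"
  by (subst hbit.simps) simp

lemma vbit_rec: "vbit i j = (if even i then odd (i div 2) \<noteq> odd j else vbit (i div 2) (j div 2))"
  by (subst vbit.simps) simp

text \<open>The middle bits are the parities that the recursions of \<open>hbit\<close> and
  \<open>vbit\<close> consult at the four child positions, so this coding commutes with the
  substitution.\<close>

definition letter_at :: "nat \<Rightarrow> nat \<Rightarrow> letter" where
  "letter_at i j = letter_of (hbit i j) (odd (i + j)) (odd i) (vbit i j)"

definition digit_at :: "nat \<Rightarrow> nat \<Rightarrow> digit" where
  "digit_at i j = dig (hbit i j) (vbit i j)"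

lemma mu_letter_at:
  assumes "j > 1"
  shows "mu (letter_at (i div 2) (j div 2)) $$ (i mod 2, j mod 2) = letter_at i j"
proof -
  have "j > 0" using assms by simp
  then show ?thesis
    using hbit_rec[of j i] vbit_rec[of i j]
    by (cases "even i"; cases "even j")
      (simp_all add: letter_at_def mu_letter_of index_block mod_2_eq_odd)
qed

lemma phi_letter_at:
  assumes "j > 1"
  shows "phi (letter_at (i div 2) (j div 2)) $$ (i mod 2, j mod 2) = digit_at i j"
proof -
  have "j > 0" using assms by simp
  then show ?thesis
    using hbit_rec[of j i] vbit_rec[of i j]
    by (cases "even i"; cases "even j")
      (simp_all add: letter_at_def digit_at_def phi_letter_of index_block mod_2_eq_odd)
qed

lemma div2_add: "(j + x * 2 ^ Suc k) div 2 = j div 2 + x * 2 ^ k" for j :: nat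
proof -
  have "j + x * 2 ^ Suc k = j + (x * 2 ^ k) * 2" by simp
  then show ?thesis by simp
qed

lemma mod2_add: "(j + x * 2 ^ Suc k) mod 2 = j mod 2" for j :: nat
proof -
  have "j + x * 2 ^ Suc k = j + (x * 2 ^ k) * 2" by simp
  then show ?thesis by (simp only: mod_mult_self1)
qed

lemma one_less_shift: "1 < j + 3 * 2 ^ Suc k" for j :: nat
proof -
  have "(1::nat) \<le> 2 ^ k" by simp
  then show ?thesis unfolding power_Suc by linarith
qed

text \<open>The corner letter \<open>LN\<close> is the letter at \<open>(0, 3)\<close>, which explains the column offset.\<close>

lemma index_T: "i < 2 ^ k \<Longrightarrow> j < 2 ^ k \<Longrightarrow> T k $$ (i, j) = letter_at i (j + 3 * 2 ^ k)"
proof (induction k arbitrary: i j)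
  case 0
  then show ?case
    by (simp add: T_def letter_at_def hbit_rec vbit_rec)
next
  case (Suc k)
  have "T (Suc k) $$ (i, j) = mu (T k $$ (i div 2, j div 2)) $$ (i mod 2, j mod 2)"
    using Suc.prems by (simp add: T_Suc index_apply_blocks)
  also have "T k $$ (i div 2, j div 2) = letter_at (i div 2) ((j + 3 * 2 ^ Suc k) div 2)"
    unfolding div2_add using Suc by (auto intro!: Suc.IH)
  also have "j mod 2 = (j + 3 * 2 ^ Suc k) mod 2"
    by (simp only: mod2_add)
  also have "mu (letter_at (i div 2) ((j + 3 * 2 ^ Suc k) div 2)) $$ (i mod 2, (j + 3 * 2 ^ Suc k) mod 2)
      = letter_at i (j + 3 * 2 ^ Suc k)"
    by (rule mu_letter_at[OF one_less_shift])
  finally show ?case .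
qed

lemma index_phi_T:
  assumes "i < 2 ^ Suc k" "j < 2 ^ Suc k"
  shows "apply_blocks phi (T k) $$ (i, j) = digit_at i (j + 3 * 2 ^ Suc k)"
proof -
  have "apply_blocks phi (T k) $$ (i, j) = phi (T k $$ (i div 2, j div 2)) $$ (i mod 2, j mod 2)"
    using assms by (simp add: index_apply_blocks)
  also have "T k $$ (i div 2, j div 2) = letter_at (i div 2) ((j + 3 * 2 ^ Suc k) div 2)"
    unfolding div2_add using assms by (auto intro!: index_T)
  also have "j mod 2 = (j + 3 * 2 ^ Suc k) mod 2"
    by (simp only: mod2_add)
  also have "phi (letter_at (i div 2) ((j + 3 * 2 ^ Suc k) div 2)) $$ (i mod 2, (j + 3 * 2 ^ Suc k) mod 2)
      = digit_at i (j + 3 * 2 ^ Suc k)"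
    by (rule phi_letter_at[OF one_less_shift])
  finally show ?thesis .
qed

text \<open>A column \<open>0 < j < 2^k\<close> has a valuation \<open>s < k\<close>. Adding a
  multiple of \<open>2^(k+1)\<close> keeps \<open>s\<close> and changes \<open>j div 2^(s+1)\<close>
  by an even number.\<close>

lemma hbit_shift: "0 < j \<Longrightarrow> j < 2 ^ k \<Longrightarrow> hbit i (j + x * 2 ^ Suc k) = hbit i j"
proof (induction k arbitrary: i j)
  case (Suc k)
  have pos: "0 < j + x * 2 ^ Suc (Suc k)" using Suc.prems by simp
  show ?case
  proof (cases "odd j")
    case True
    have "even (x * 2 ^ Suc k)" by simp
    with True show ?thesis
      unfolding hbit_rec[OF pos] hbit_rec[OF Suc.prems(1)] div2_add by simp
  next
    case False
    then have "j div 2 > 0" "j div 2 < 2 ^ k"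
      using Suc.prems by (auto elim!: evenE)
    then have "hbit (i div 2) (j div 2 + x * 2 ^ Suc k) = hbit (i div 2) (j div 2)"
      by (rule Suc.IH)
    with False show ?thesis
      unfolding hbit_rec[OF pos] hbit_rec[OF Suc.prems(1)] div2_add by simp
  qed
qed simp

text \<open>The valuation \<open>s\<close> of \<open>i + 1\<close> is below \<open>k\<close>, so the
  shift changes \<open>j div 2^s\<close> by an even number.\<close>

lemma vbit_shift: "i + 1 < 2 ^ k \<Longrightarrow> vbit i (j + x * 2 ^ k) = vbit i j"
proof (induction k arbitrary: i j)
  case (Suc k)
  show ?case
  proof (cases "even i")
    case True
    then show ?thesis by (simp add: vbit_rec[of i])
  next
    case False
    then have "i div 2 + 1 < 2 ^ k" using Suc.prems by (auto elim!: oddE)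
    then show ?thesis
      using False Suc.IH[of "i div 2" "j div 2"]
      by (simp only: vbit_rec[of i "j + x * 2 ^ Suc k"] vbit_rec[of i j] div2_add if_False)
  qed
qed simp

text \<open>Columns are counted from \<open>c + 1\<close>, which keeps them away from the column \<open>0\<close>.\<close>

definition window :: "nat \<Rightarrow> nat \<Rightarrow> nat \<Rightarrow> digit mat" where
  "window n r c = mat n n (\<lambda>(a, b). digit_at (r + a) (c + 1 + b))"

lemma S_patterns_eq: "S_patterns n n = (\<Union>r c. {window n r c})"
proof (intro equalityI subsetI)
  fix X assume "X \<in> S_patterns n n"
  then obtain k r c where rc: "r + n \<le> 2 ^ Suc k" "c + n \<le> 2 ^ Suc k"
    and X: "X = mat n n (\<lambda>(i, j). apply_blocks phi (T k) $$ (r + i, c + j))"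
    by (auto simp: S_patterns_def patterns_def)
  \<comment> \<open>The offset is the column shift of the quadrant; the \<open>- 1\<close> cancels
    the \<open>+ 1\<close> built into \<open>window\<close>.\<close>
  have "X = window n r (c + 3 * 2 ^ Suc k - 1)"
    unfolding X window_def
  proof (rule cong_mat, goal_cases)
    case (3 i j)
    then have "r + i < 2 ^ Suc k" "c + j < 2 ^ Suc k"
      using rc by linarith+
    moreover have "c + 3 * 2 ^ Suc k - 1 + 1 + j = c + j + 3 * 2 ^ Suc k"
      by simp
    ultimately show ?case
      using index_phi_T[of "r + i" k "c + j"] by (simp only: case_prod_conv)
  qed (rule refl)+
  then show "X \<in> (\<Union>r c. {window n r c})" by auto
next
  fix X assume "X \<in> (\<Union>r c. {window n r c})"
  then obtain r c where X: "X = window n r c" by auto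
  \<comment> \<open>This \<open>k\<close> is so large that the window fits into the quadrant and its
    rows and columns are small enough for the offset to be invisible.\<close>
  define k where "k = r + c + n + 1"
  have k: "k < 2 ^ k" by (rule less_exp)
  have "X = mat n n (\<lambda>(i, j). apply_blocks phi (T k) $$ (r + i, (c + 1) + j))"
    unfolding X window_def
  proof (rule cong_mat, goal_cases)
    case (3 i j)
    then have *: "r + i + 1 < 2 ^ k" "c + 1 + j < 2 ^ k"
      using k unfolding k_def by linarith+
    then have **: "r + i + 1 < 2 ^ Suc k" "c + 1 + j < 2 ^ Suc k"
      unfolding power_Suc by linarith+
    have "digit_at (r + i) (c + 1 + j + 3 * 2 ^ Suc k) = digit_at (r + i) (c + 1 + j)"
      using hbit_shift[OF _ *(2), of "r + i" 3] vbit_shift[OF **(1), of "c + 1 + j" 3]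
      by (simp add: digit_at_def del: power_Suc)
    moreover have "r + i < 2 ^ Suc k" using **(1) by linarith
    ultimately show ?case
      using index_phi_T[of "r + i" k "c + 1 + j"] **(2) by (simp only: case_prod_conv)
  qed (rule refl)+
  moreover have "r + n \<le> 2 ^ Suc k" "(c + 1) + n \<le> 2 ^ Suc k"
    using k unfolding k_def by simp_all
  ultimately have "X \<in> patterns (apply_blocks phi (T k)) n n"
    unfolding patterns_def dim_apply_blocks dim_T power_Suc by blast
  then show "X \<in> S_patterns n n"
    unfolding S_patterns_def by blast
qed

section \<open>Lines of given valuation as square waves\<close>

lemma hbit_pow_mult: "j > 0 \<Longrightarrow> hbit i (2 ^ t * j) = hbit (i div 2 ^ t) j"
proof (induction t arbitrary: i)
  case (Suc t)
  then have "hbit i (2 ^ Suc t * j) = hbit (i div 2) (2 ^ t * j)"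
    by (subst hbit_rec) simp_all
  with Suc show ?case by (simp add: div_mult2_eq)
qed simp

lemma vbit_pow_mult: "i + 1 = 2 ^ t * (l + 1) \<Longrightarrow> vbit i j = vbit l (j div 2 ^ t)"
proof (induction t arbitrary: i j)
  case (Suc t)
  have "odd i" using Suc.prems by (metis even_Suc Suc_eq_plus1 dvd_mult2 dvd_refl power_Suc)
  then obtain i' where i': "i = 2 * i' + 1" by (rule oddE)
  with Suc.prems have "i' + 1 = 2 ^ t * (l + 1)" by simp
  then have "vbit i' (j div 2) = vbit l (j div 2 div 2 ^ t)" by (rule Suc.IH)
  with i' show ?case by (subst vbit_rec) (simp add: div_mult2_eq)
qed simp

text \<open>The residue says that \<open>j = 2^t * (2 * m + 1)\<close> with
  \<open>m = j div (2 * 2^t)\<close>; \<open>t\<close> halvings lead to an odd column, where the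
  recursion stops.\<close>

lemma hbit_half:
  assumes "j mod (2 * 2 ^ t) = 2 ^ t"
  shows "hbit i j = odd (i div (2 * 2 ^ t) + j div (2 * 2 ^ t))"
proof -
  define m where "m = j div (2 * 2 ^ t)"
  have "j = m * (2 * 2 ^ t) + 2 ^ t"
    using div_mult_mod_eq[of j "2 * 2 ^ t"] assms by (simp add: m_def)
  then have j: "j = 2 ^ t * (2 * m + 1)" by (simp add: algebra_simps)
  have "hbit i j = hbit (i div 2 ^ t) (2 * m + 1)"
    unfolding j by (rule hbit_pow_mult) simp
  also have "\<dots> = odd (i div 2 ^ t div 2 + m)"
    by (subst hbit_rec) simp_all
  also have "i div 2 ^ t div 2 = i div (2 * 2 ^ t)"
    by (simp add: div_mult2_eq[symmetric] mult.commute)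
  finally show ?thesis by (simp add: m_def)
qed

text \<open>For rows it is \<open>i + 1\<close> that has valuation \<open>t\<close>. Since
  \<open>i + 1\<close> is not a multiple of \<open>2 * 2^t\<close>, it has the same quotient as
  \<open>i\<close>.\<close>

lemma vbit_half:
  assumes "(i + 1) mod (2 * 2 ^ t) = 2 ^ t"
  shows "vbit i j = (odd (i div (2 * 2 ^ t)) \<noteq> odd (j div 2 ^ t))"
proof -
  define l where "l = (i + 1) div (2 * 2 ^ t)"
  have i1: "i + 1 = l * (2 * 2 ^ t) + 2 ^ t"
    using div_mult_mod_eq[of "i + 1" "2 * 2 ^ t"] assms by (simp add: l_def)
  then have "i + 1 = 2 ^ t * (2 * l + 1)" by (simp add: algebra_simps)
  then have "vbit i j = vbit (2 * l) (j div 2 ^ t)" by (rule vbit_pow_mult)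
  also have "\<dots> = (odd l \<noteq> odd (j div 2 ^ t))"
    by (subst vbit_rec) simp
  also have "l = i div (2 * 2 ^ t)"
  proof -
    have "i div (2 * 2 ^ t) = l"
    proof (rule div_nat_eqI)
      have "(2::nat) ^ t > 0" "2 * 2 ^ t * l = l * (2 * 2 ^ t)"
        "2 * 2 ^ t * Suc l = l * (2 * 2 ^ t) + 2 * 2 ^ t"
        by simp_all
      with i1 show "2 * 2 ^ t * l \<le> i" "i < 2 * 2 ^ t * Suc l"
        by linarith+
    qed
    then show ?thesis by simp
  qed
  finally show ?thesis .
qed

lemma mod_double_eqD:
  fixes i i' :: nat
  assumes "i mod (2 * m) = i' mod (2 * m)"
  shows "i div 2 mod m = i' div 2 mod m" "even i = even i'"
proof -
  have "i div 2 mod m = i mod (2 * m) div 2" for i :: nat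
    by (simp add: mod_mult2_eq)
  with assms show "i div 2 mod m = i' div 2 mod m" by simp
  have "i mod (2 * m) mod 2 = i' mod (2 * m) mod 2" using assms by simp
  then have "i mod 2 = i' mod 2" by (simp only: mod_mod_cancel[OF dvd_triv_left])
  then show "even i = even i'" by presburger
qed

text \<open>A column not divisible by \<open>2^t\<close> has a valuation \<open>s < t\<close>. Its
  bit involves only the parities of quotients by \<open>2^(s+1)\<close>, and residues modulo
  \<open>2^(t+1)\<close> determine these.\<close>

lemma hbit_cong:
  assumes "i mod (2 * 2 ^ t) = i' mod (2 * 2 ^ t)" "j mod (2 * 2 ^ t) = j' mod (2 * 2 ^ t)"
    and "\<not> 2 ^ t dvd j"
  shows "hbit i j = hbit i' j'"
  using assms
proof (induction t arbitrary: i i' j j')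
  case (Suc t)
  note d = mod_double_eqD[OF Suc.prems(1)] mod_double_eqD[OF Suc.prems(2)]
  have "j > 0" using Suc.prems(3) by (intro gr0I) auto
  have "\<not> 2 ^ Suc t dvd j'"
    using Suc.prems(2,3) dvd_mod_iff[of "2 ^ Suc t" "2 * 2 ^ Suc t" j]
      dvd_mod_iff[of "2 ^ Suc t" "2 * 2 ^ Suc t" j'] by (simp del: power_Suc)
  then have "j' > 0" by (intro gr0I) auto
  show ?case
  proof (cases "even j")
    case True
    then have "\<not> 2 ^ t dvd j div 2"
      using Suc.prems(3) by (auto elim!: evenE)
    then have "hbit (i div 2) (j div 2) = hbit (i' div 2) (j' div 2)"
      using d by (intro Suc.IH) simp_all
    with True d \<open>j > 0\<close> \<open>j' > 0\<close> show ?thesis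
      by (simp add: hbit_rec[of j] hbit_rec[of j'])
  next
    case False
    have "even (i div 2) = even (i' div 2)" "even (j div 2) = even (j' div 2)"
      using mod_double_eqD(2)[of "i div 2" "2 ^ t" "i' div 2"]
        mod_double_eqD(2)[of "j div 2" "2 ^ t" "j' div 2"] d by simp_all
    with False d(2,4) \<open>j > 0\<close> \<open>j' > 0\<close> show ?thesis
      by (simp add: hbit_rec[of j] hbit_rec[of j'])
  qed
qed simp

lemma vbit_cong:
  assumes "i mod (2 * 2 ^ t) = i' mod (2 * 2 ^ t)" "j mod (2 * 2 ^ t) = j' mod (2 * 2 ^ t)"
    and "\<not> 2 ^ t dvd i + 1"
  shows "vbit i j = vbit i' j'"
  using assms
proof (induction t arbitrary: i i' j j')
  case (Suc t)
  note d = mod_double_eqD[OF Suc.prems(1)] mod_double_eqD[OF Suc.prems(2)]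
  show ?case
  proof (cases "even i")
    case False
    then have "i + 1 = 2 * (i div 2 + 1)" by presburger
    with Suc.prems(3) have "\<not> 2 ^ t dvd i div 2 + 1"
      by (metis dvd_refl mult_dvd_mono power_Suc)
    then have "vbit (i div 2) (j div 2) = vbit (i' div 2) (j' div 2)"
      using d by (intro Suc.IH) simp_all
    with False d(2) show ?thesis by (simp add: vbit_rec[of i] vbit_rec[of i'])
  next
    case True
    have "even (i div 2) = even (i' div 2)"
      using mod_double_eqD(2)[of "i div 2" "2 ^ t" "i' div 2"] d by simp
    with True d(2,4) show ?thesis by (simp add: vbit_rec[of i] vbit_rec[of i'])
  qed
qed simp

section \<open>Flips of the creases at a vertex\<close>

text \<open>
  Says whether the 2-adic valuation of \<open>r + 1\<close> exceeds that of \<open>c + 1\<close>. Exactly one of the two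
  creases through the vertex between rows \<open>r\<close>, \<open>r + 1\<close> and columns \<open>c\<close>, \<open>c + 1\<close> changes there.
\<close>

function hflip :: "nat \<Rightarrow> nat \<Rightarrow> bool" where
  "hflip r c = (if even r then False else even c \<or> hflip (r div 2) (c div 2))"
  by pat_completeness auto
termination by (relation "measure fst") (auto elim: oddE)

declare hflip.simps [simp del]

lemma hflip_even_row: "even r \<Longrightarrow> \<not> hflip r c"
  by (simp add: hflip.simps)

lemma hflip_odd_row: "odd r \<Longrightarrow> hflip r c \<longleftrightarrow> even c \<or> hflip (r div 2) (c div 2)"
  by (subst hflip.simps) simp

text \<open>If column \<open>c + 1\<close> has valuation \<open>s\<close>, its wave has runs of
  length \<open>2^(s+1)\<close>, so it changes after row \<open>r\<close> iff \<open>2^(s+1)\<close>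
  divides \<open>r + 1\<close>.\<close>

lemma hbit_Suc_row: "hbit (Suc r) (Suc c) = (hbit r (Suc c) \<noteq> hflip r c)"
proof (induction r c rule: hflip.induct)
  case (1 r c)
  have rec: "hbit i (Suc c) = (if even c then odd (i div 2 + c div 2) else hbit (i div 2) (Suc (c div 2)))" for i
    by (subst hbit_rec) auto
  show ?case
  proof (cases "even r")
    case True
    then have "Suc r div 2 = r div 2" by simp
    with True show ?thesis unfolding rec by (simp add: hflip.simps[of r c])
  next
    case False
    then have "Suc r div 2 = Suc (r div 2)" by simp
    with False 1 show ?thesis unfolding rec by (auto simp add: hflip.simps[of r c])
  qed
qed

text \<open>Complementary to the column case: if \<open>r + 1\<close> has valuation
  \<open>s\<close>, the row changes before column \<open>c + 1\<close> iff \<open>2^s\<close>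
  divides \<open>c + 1\<close>, which is the negation of \<open>hflip\<close>.\<close>

lemma vbit_Suc_col: "vbit r (Suc c) = (vbit r c = hflip r c)"
proof (induction r c rule: hflip.induct)
  case (1 r c)
  show ?case
  proof (cases "even r")
    case True
    then show ?thesis
      unfolding vbit_rec[of r "Suc c"] vbit_rec[of r c] by (auto simp add: hflip.simps[of r c])
  next
    case False
    then show ?thesis
      using 1 unfolding vbit_rec[of r "Suc c"] vbit_rec[of r c]
      by (cases "even c") (simp_all add: hflip.simps[of r c])
  qed
qed


section \<open>Windows at positions with given residues\<close>

definition same_window :: "nat \<Rightarrow> nat \<times> nat \<Rightarrow> nat \<times> nat \<Rightarrow> bool" where
  "same_window n p q \<longleftrightarrow> (\<forall>a<n. \<forall>b<n.
     hbit (fst p + a) (snd p + 1 + b) = hbit (fst q + a) (snd q + 1 + b) \<and>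
     vbit (fst p + a) (snd p + 1 + b) = vbit (fst q + a) (snd q + 1 + b))"

lemma add_div_carry:
  fixes r a m :: nat
  assumes "r mod m + a < 2 * m"
  shows "(r + a) div m = r div m + of_bool (m \<le> r mod m + a)"
    and "(r + a) mod m = r mod m + a - m * of_bool (m \<le> r mod m + a)"
proof -
  have "m > 0" using assms by (cases m) auto
  have e: "r + a = m * (r div m) + (r mod m + a)" by simp
  have "(r + a) div m = r div m + (r mod m + a) div m"
    by (subst e, subst div_mult_self4) (use \<open>m > 0\<close> in simp_all)
  moreover have "(r mod m + a) div m = of_bool (m \<le> r mod m + a)"
    using assms \<open>m > 0\<close> by (auto simp: div_nat_eqI)
  ultimately show "(r + a) div m = r div m + of_bool (m \<le> r mod m + a)" by simp
  have "(r + a) mod m = (r mod m + a) mod m" by (simp add: mod_add_left_eq)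
  also have "\<dots> = r mod m + a - m * of_bool (m \<le> r mod m + a)"
    using assms by (auto simp: le_mod_geq)
  finally show "(r + a) mod m = r mod m + a - m * of_bool (m \<le> r mod m + a)" .
qed

lemma mod_add_cong:
  fixes r r' m :: nat
  shows "r mod m = r' mod m \<Longrightarrow> (r + a) mod m = (r' + a) mod m"
  by (metis mod_add_left_eq)

lemma parity_div_cong:
  fixes j j' m :: nat
  shows "j mod (2 * m) = j' mod (2 * m) \<Longrightarrow> odd (j div m) = odd (j' div m)"
proof -
  have "(j div m) mod 2 = j mod (2 * m) div m" for j :: nat
    by (cases "m = 0") (simp_all add: mod_mult2_eq[of j m 2] mult.commute[of 2])
  then show "j mod (2 * m) = j' mod (2 * m) \<Longrightarrow> odd (j div m) = odd (j' div m)"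
    by (metis mod_2_eq_odd of_bool_eq_iff)
qed

text \<open>Here \<open>t\<close> is the \<alpha> of the formula. The upper bound leaves room for at
  most one row and one column divisible by \<open>M\<close> (rows counted from 1); the lower bound
  lets the window determine residues modulo \<open>M\<close>.\<close>

locale window_scale =
  fixes t n :: nat
  assumes lower: "2 ^ t < n" and upper: "n \<le> 2 * 2 ^ t"
begin

abbreviation K :: nat where "K \<equiv> 2 ^ t"
abbreviation M :: nat where "M \<equiv> 2 * 2 ^ t"

text \<open>
  For a residue \<open>\<rho>\<close> of the position, the window sees a line of valuation exactly \<open>t\<close>, respectively
  a line of higher valuation. The full row is followed by another row of the window in case of
  \<open>row_crossing\<close>; the full column is the first one of the window in case of \<open>col_edge\<close>.
\<close>

definition sees_half :: "nat \<Rightarrow> bool" where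
  "sees_half \<rho> \<longleftrightarrow> \<rho> < K \<or> M + K \<le> \<rho> + n"

definition sees_full :: "nat \<Rightarrow> bool" where
  "sees_full \<rho> \<longleftrightarrow> M \<le> \<rho> + n"

definition row_crossing :: "nat \<Rightarrow> bool" where
  "row_crossing \<rho> \<longleftrightarrow> M < \<rho> + n"

definition col_edge :: "nat \<Rightarrow> bool" where
  "col_edge \<gamma> \<longleftrightarrow> \<gamma> + 1 = M"

text \<open>
  The components of a state are the parities of the vertex \<open>(R, C)\<close> of the \<open>M\<close>-grid, the first bits
  of the full column and of the full row, and whether it is the column or the row that flips at
  the vertex. The half column only shows whether the two parities differ.
\<close>

fun view :: "nat \<Rightarrow> nat \<Rightarrow> bool \<times> bool \<times> bool \<times> bool \<times> bool \<Rightarrow> bool \<times> bool \<times> bool \<times> bool \<times> bool" where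
  "view \<rho> \<gamma> (x, y, h, v, d) = (sees_half \<gamma> \<and> x \<noteq> y, sees_half \<rho> \<and> x, sees_full \<gamma> \<and> h,
     sees_full \<rho> \<and> v, sees_full \<gamma> \<and> (row_crossing \<rho> \<or> sees_full \<rho> \<and> \<not> col_edge \<gamma>) \<and> d)"

definition state :: "nat \<times> nat \<Rightarrow> bool \<times> bool \<times> bool \<times> bool \<times> bool" where
  "state p = (let R = fst p div M; C = snd p div M in
     (even R, even C, hbit R (Suc C), vbit R ((snd p + 1) div M), hflip R C))"

lemma mod_M: "r mod M < M"
  by (rule mod_less_divisor) simp

lemma add_less: "a < n \<Longrightarrow> r mod M + a + 1 < 2 * M"
  using upper mod_M[of r] by linarith

lemma row_div: "a < n \<Longrightarrow> (r + a) div M = r div M + of_bool (M \<le> r mod M + a)"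
  using add_less[of a r] by (intro add_div_carry) linarith

lemma row_mod: "a < n \<Longrightarrow> (r + a + 1) mod M = r mod M + a + 1 - M * of_bool (M \<le> r mod M + a + 1)"
  using add_less[of a r] add_div_carry(2)[of r M "a + 1"] by (simp only: add.assoc)

lemma col_div: "b < n \<Longrightarrow> (c + 1 + b) div M = c div M + of_bool (M \<le> c mod M + 1 + b)"
  using add_less[of b c] add_div_carry(1)[of c M "1 + b"] by (simp only: ac_simps)

lemma full_iff: "a < n \<Longrightarrow> (r + a + 1) mod M = 0 \<longleftrightarrow> r mod M + a + 1 = M"
  unfolding row_mod using add_less[of a r] by (cases "M \<le> r mod M + a + 1") simp_all

lemma half_iff: "a < n \<Longrightarrow> (r + a + 1) mod M = K \<longleftrightarrow> r mod M + a + 1 = K \<or> r mod M + a + 1 = M + K"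
proof -
  have "K > 0" by simp
  then show "a < n \<Longrightarrow> ?thesis"
    unfolding row_mod using add_less[of a r]
    by (cases "M \<le> r mod M + a + 1") (simp_all only: of_bool_eq mult_1_right mult_0_right, linarith+)
qed

lemma sees_half_iff: "sees_half (r mod M) \<longleftrightarrow> (\<exists>a<n. (r + a + 1) mod M = K)"
proof
  assume "sees_half (r mod M)"
  then consider "r mod M < K" | "M + K \<le> r mod M + n" by (auto simp: sees_half_def)
  then obtain a where "r mod M + a + 1 = K \<or> r mod M + a + 1 = M + K" "a < n"
  proof cases
    case 1
    show ?thesis by (rule that[of "K - 1 - r mod M"]) (use 1 lower in linarith)+
  next
    case 2
    show ?thesis by (rule that[of "M + K - 1 - r mod M"]) (use 2 mod_M[of r] in linarith)+
  qed
  then show "\<exists>a<n. (r + a + 1) mod M = K" using half_iff by blast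
next
  assume "\<exists>a<n. (r + a + 1) mod M = K"
  then obtain a where "a < n" "r mod M + a + 1 = K \<or> r mod M + a + 1 = M + K"
    using half_iff by blast
  then show "sees_half (r mod M)" by (auto simp: sees_half_def)
qed

text \<open>The column is \<open>M\<close> times the grid column \<open>C + 1\<close>, so its bit is
  read at grid row \<open>R\<close> or \<open>R + 1\<close>, and the two readings differ by the flip
  at the vertex.\<close>

lemma hbit_full:
  assumes "a < n" "b < n" "(c + 1 + b) mod M = 0"
  shows "hbit (r + a) (c + 1 + b) = (hbit (r div M) (Suc (c div M)) \<noteq>
    (M \<le> r mod M + a \<and> hflip (r div M) (c div M)))"
proof -
  have "c mod M + 1 + b = M" using assms full_iff[of b c] by (simp add: ac_simps)
  then have "(c + 1 + b) div M = Suc (c div M)" using col_div[OF assms(2), of c] by simp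
  then have "c + 1 + b = M * Suc (c div M)"
    using div_mult_mod_eq[of "c + 1 + b" M] assms(3) by (metis add_0_right mult.commute)
  then have "hbit (r + a) (c + 1 + b) = hbit ((r + a) div M) (Suc (c div M))"
    using hbit_pow_mult[of "Suc (c div M)" "r + a" "Suc t"] by simp
  then show ?thesis
    using row_div[OF assms(1), of r] by (simp add: hbit_Suc_row)
qed

text \<open>The reference value is the first entry of the row in the window. On
  \<open>col_edge\<close> this entry already lies beyond the vertex, so no flip is seen.\<close>

lemma vbit_full:
  assumes "a < n" "b < n" "(r + a + 1) mod M = 0"
  shows "vbit (r + a) (c + 1 + b) = (vbit (r div M) ((c + 1) div M) \<noteq>
    (\<not> col_edge (c mod M) \<and> M \<le> c mod M + 1 + b \<and> \<not> hflip (r div M) (c div M)))"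
proof -
  have "r mod M + a + 1 = M" using assms full_iff[of a r] by simp
  then have "r + a + 1 = M * (r div M + 1)"
    using mult_div_mod_eq[of M r] by (simp add: algebra_simps)
  then have "vbit (r + a) (c + 1 + b) = vbit (r div M) ((c + 1 + b) div M)"
    using vbit_pow_mult[of "r + a" "Suc t" "r div M" "c + 1 + b"] by simp
  moreover have "(c + 1) div M = c div M + of_bool (M \<le> c mod M + 1)"
    using col_div[of 0 c] lower by simp
  moreover have "M \<le> c mod M + 1 \<longleftrightarrow> col_edge (c mod M)"
    using mod_M[of c] unfolding col_edge_def by linarith
  ultimately show ?thesis
    using col_div[OF assms(2), of c] by (auto simp: vbit_Suc_col col_edge_def)
qed

lemma not_dvd_K: "j mod M \<noteq> 0 \<Longrightarrow> j mod M \<noteq> K \<Longrightarrow> \<not> K dvd j"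
  by (auto elim!: dvdE simp: mult.commute[of 2] mod_mult_mult1)

lemma parity_row_cong:
  assumes "r mod M = r' mod M" "a < n"
  shows "odd ((r + a) div M) = odd ((r' + a) div M) \<longleftrightarrow> even (r div M) = even (r' div M)"
  using assms by (auto simp: row_div)

lemma parity_col_cong:
  assumes "c mod M = c' mod M" "b < n"
  shows "odd ((c + 1 + b) div M) = odd ((c' + 1 + b) div M) \<longleftrightarrow> even (c div M) = even (c' div M)"
  unfolding col_div[OF assms(2)] using assms by auto

text \<open>Each component is read off particular entries: the half row in the first column, the
  half column in the first row, a full line at its first entry and, for the flip, just past the
  vertex.\<close>

lemma view_eq_if_same_window:
  assumes r: "r mod M = r' mod M" and c: "c mod M = c' mod M"
    and same: "same_window n (r, c) (r', c')"
  shows "view (r mod M) (c mod M) (state (r, c)) = view (r mod M) (c mod M) (state (r', c'))"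
proof -
  have eqh: "hbit (r + a) (c + 1 + b) = hbit (r' + a) (c' + 1 + b)"
    and eqv: "vbit (r + a) (c + 1 + b) = vbit (r' + a) (c' + 1 + b)" if "a < n" "b < n" for a b
    using same that by (auto simp: same_window_def)
  have n0: "0 < n" using lower by simp
  note par = parity_row_cong[OF r] parity_col_cong[OF c]
  have x: "even (r div M) = even (r' div M)" if "sees_half (r mod M)"
  proof -
    from that obtain a where a: "a < n" "(r + a + 1) mod M = K" by (auto simp: sees_half_iff)
    then have "(r' + a + 1) mod M = K" using mod_add_cong[OF r, of "a + 1"] by (simp add: ac_simps)
    then have "(odd ((r + a) div M) \<noteq> odd ((c + 1 + 0) div K)) = (odd ((r' + a) div M) \<noteq> odd ((c' + 1 + 0) div K))"
      using a eqv[OF a(1) n0] vbit_half[of "r + a" t] vbit_half[of "r' + a" t] by simp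
    moreover have "odd ((c + 1 + 0) div K) = odd ((c' + 1 + 0) div K)"
      using mod_add_cong[OF c, of 1] by (intro parity_div_cong) simp
    ultimately show ?thesis using par(1)[OF a(1)] by blast
  qed
  have xy: "(even (r div M) \<noteq> even (c div M)) = (even (r' div M) \<noteq> even (c' div M))"
    if "sees_half (c mod M)"
  proof -
    from that obtain b where b: "b < n" "(c + 1 + b) mod M = K" by (auto simp: sees_half_iff ac_simps)
    then have "(c' + 1 + b) mod M = K" using mod_add_cong[OF c, of "1 + b"] by (simp add: ac_simps)
    then have "odd ((r + 0) div M + (c + 1 + b) div M) = odd ((r' + 0) div M + (c' + 1 + b) div M)"
      using b eqh[OF n0 b(1)] hbit_half[of "c + 1 + b" t] hbit_half[of "c' + 1 + b" t] by simp
    then show ?thesis using par(2)[OF b(1)] by auto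
  qed
  have h: "hbit (r div M) (Suc (c div M)) = hbit (r' div M) (Suc (c' div M)) \<and>
      (row_crossing (r mod M) \<longrightarrow> hflip (r div M) (c div M) = hflip (r' div M) (c' div M))"
    if "sees_full (c mod M)"
  proof -
    obtain b where b: "b < n" "c mod M + b + 1 = M"
      by (rule that[of "M - 1 - c mod M"]) (use mod_M[of c] \<open>sees_full (c mod M)\<close> in \<open>unfold sees_full_def, linarith\<close>)+
    have z: "(c + 1 + b) mod M = 0" using full_iff[OF b(1), of c] b(2) by (simp add: ac_simps)
    then have z': "(c' + 1 + b) mod M = 0" using mod_add_cong[OF c, of "1 + b"] by (simp add: ac_simps)
    have rM: "r mod M < M" by (rule mod_M)
    have 1: "hbit (r div M) (Suc (c div M)) = hbit (r' div M) (Suc (c' div M))"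
      using eqh[OF n0 b(1)] hbit_full[OF n0 b(1) z, of r] hbit_full[OF n0 b(1) z', of r'] rM r
      by (simp add: not_le)
    moreover have "hflip (r div M) (c div M) = hflip (r' div M) (c' div M)" if "row_crossing (r mod M)"
    proof -
      \<comment> \<open>This is the first row below the vertex, whereas row 0 of the window lies
        above it; comparing the two reveals the flip of the full column.\<close>
      have a: "M - r mod M < n" "M \<le> r mod M + (M - r mod M)"
        using that rM unfolding row_crossing_def by linarith+
      show ?thesis
        using eqh[OF a(1) b(1)] hbit_full[OF a(1) b(1) z, of r] hbit_full[OF a(1) b(1) z', of r'] a(2) r 1 c
        by auto
    qed
    ultimately show ?thesis by blast
  qed
  have v: "vbit (r div M) ((c + 1) div M) = vbit (r' div M) ((c' + 1) div M) \<and>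
      (sees_full (c mod M) \<and> \<not> col_edge (c mod M) \<longrightarrow> hflip (r div M) (c div M) = hflip (r' div M) (c' div M))"
    if "sees_full (r mod M)"
  proof -
    obtain a where a: "a < n" "r mod M + a + 1 = M"
      by (rule that[of "M - 1 - r mod M"]) (use mod_M[of r] \<open>sees_full (r mod M)\<close> in \<open>unfold sees_full_def, linarith\<close>)+
    have z: "(r + a + 1) mod M = 0" using full_iff[OF a(1), of r] a(2) by (simp add: ac_simps)
    then have z': "(r' + a + 1) mod M = 0" using mod_add_cong[OF r, of "a + 1"] by (simp add: ac_simps)
    have cM: "c mod M < M" by (rule mod_M)
    have 1: "vbit (r div M) ((c + 1) div M) = vbit (r' div M) ((c' + 1) div M)"
      using eqv[OF a(1) n0] vbit_full[OF a(1) n0 z, of c] vbit_full[OF a(1) n0 z', of c'] cM c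
      by (auto simp: col_edge_def)
    moreover have "hflip (r div M) (c div M) = hflip (r' div M) (c' div M)"
      if "sees_full (c mod M)" "\<not> col_edge (c mod M)"
    proof -
      \<comment> \<open>This is the full column itself, where the next block of the grid begins.
        Column 0 of the window precedes it because \<open>col_edge\<close> is excluded.\<close>
      have b: "M - 1 - c mod M < n" "c mod M + 1 + (M - 1 - c mod M) = M"
        using that(1) cM unfolding sees_full_def by linarith+
      show ?thesis
        using eqv[OF a(1) b(1)] vbit_full[OF a(1) b(1) z, of c] vbit_full[OF a(1) b(1) z', of c'] b(2) c 1 that
        by auto
    qed
    ultimately show ?thesis by blast
  qed
  show ?thesis
    using x xy h v by (auto simp: state_def Let_def)
qed

text \<open>Lines of valuation below \<open>t\<close> are fixed by the residues. A line of valuation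
  exactly \<open>t\<close> needs one parity component, and a line of higher valuation needs its
  first bit and, beyond the vertex, the flip; the view shows each of these whenever it
  matters.\<close>

lemma same_window_if_view_eq:
  assumes r: "r mod M = r' mod M" and c: "c mod M = c' mod M"
    and view: "view (r mod M) (c mod M) (state (r, c)) = view (r mod M) (c mod M) (state (r', c'))"
  shows "same_window n (r, c) (r', c')"
  unfolding same_window_def fst_conv snd_conv
proof (intro allI impI conjI)
  fix a b assume a: "a < n" and b: "b < n"
  note par = parity_row_cong[OF r] parity_col_cong[OF c]
  have cm: "(c + 1 + b) mod M = (c' + 1 + b) mod M"
    using mod_add_cong[OF c, of "1 + b"] by (simp add: ac_simps)
  have rm: "(r + a + 1) mod M = (r' + a + 1) mod M" "(r + a) mod M = (r' + a) mod M"
    using mod_add_cong[OF r, of "a + 1"] mod_add_cong[OF r, of a] by (simp_all add: ac_simps)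
  show "hbit (r + a) (c + 1 + b) = hbit (r' + a) (c' + 1 + b)"
  proof -
    consider (full) "(c + 1 + b) mod M = 0" | (half) "(c + 1 + b) mod M = K"
      | (other) "\<not> K dvd c + 1 + b"
      using not_dvd_K by blast
    then show ?thesis
    proof cases
      case full
      then have e: "c mod M + 1 + b = M" using full_iff[OF b, of c] by (simp add: ac_simps)
      then have "sees_full (c mod M)" using b by (auto simp: sees_full_def)
      moreover have "row_crossing (r mod M)" if "M \<le> r mod M + a"
        using that a unfolding row_crossing_def by linarith
      ultimately have "hbit (r div M) (Suc (c div M)) = hbit (r' div M) (Suc (c' div M))"
        "M \<le> r mod M + a \<Longrightarrow> hflip (r div M) (c div M) = hflip (r' div M) (c' div M)"
        using view unfolding state_def by (simp_all add: Let_def)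
      then show ?thesis
        unfolding hbit_full[OF a b full] hbit_full[OF a b full[unfolded cm]] r[symmetric]
        by blast
    next
      case half
      then have "sees_half (c mod M)" using b by (auto simp: sees_half_iff ac_simps)
      with view have "(even (r div M) \<noteq> even (c div M)) = (even (r' div M) \<noteq> even (c' div M))"
        by (auto simp: state_def Let_def)
      then have "odd ((r + a) div M + (c + 1 + b) div M) = odd ((r' + a) div M + (c' + 1 + b) div M)"
        using par(1)[OF a] par(2)[OF b] by auto
      then show ?thesis
        using half cm hbit_half[of "c + 1 + b" t] hbit_half[of "c' + 1 + b" t] by simp
    next
      case other
      then show ?thesis using rm cm by (intro hbit_cong) auto
    qed
  qed
  show "vbit (r + a) (c + 1 + b) = vbit (r' + a) (c' + 1 + b)"
  proof -
    consider (full) "(r + a + 1) mod M = 0" | (half) "(r + a + 1) mod M = K"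
      | (other) "\<not> K dvd r + a + 1"
      using not_dvd_K by blast
    then show ?thesis
    proof cases
      case full
      then have e: "r mod M + a + 1 = M" using full_iff[OF a, of r] by simp
      then have "sees_full (r mod M)" using a by (auto simp: sees_full_def)
      moreover have "sees_full (c mod M)" if "M \<le> c mod M + 1 + b"
        using that b unfolding sees_full_def by linarith
      ultimately have "vbit (r div M) ((c + 1) div M) = vbit (r' div M) ((c' + 1) div M)"
        "M \<le> c mod M + 1 + b \<Longrightarrow> \<not> col_edge (c mod M) \<Longrightarrow>
          hflip (r div M) (c div M) = hflip (r' div M) (c' div M)"
        using view unfolding state_def by (simp_all add: Let_def)
      then show ?thesis
        unfolding vbit_full[OF a b full] vbit_full[OF a b full[unfolded rm(1)]] c[symmetric]
        by blast
    next
      case half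
      then have "sees_half (r mod M)" using a by (auto simp: sees_half_iff)
      with view have "even (r div M) = even (r' div M)"
        by (auto simp: state_def Let_def)
      then have "odd ((r + a) div M) = odd ((r' + a) div M)"
        using par(1)[OF a] by blast
      moreover have "odd ((c + 1 + b) div K) = odd ((c' + 1 + b) div K)"
        by (rule parity_div_cong[OF cm])
      ultimately show ?thesis
        using half rm vbit_half[of "r + a" t] vbit_half[of "r' + a" t] by simp
    next
      case other
      then show ?thesis using rm cm by (intro vbit_cong) auto
    qed
  qed
qed

lemma same_window_iff_view_eq:
  assumes "r mod M = r' mod M" "c mod M = c' mod M"
  shows "same_window n (r, c) (r', c') \<longleftrightarrow>
    view (r mod M) (c mod M) (state (r, c)) = view (r mod M) (c mod M) (state (r', c'))"
  using view_eq_if_same_window same_window_if_view_eq assms by blast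

end

section \<open>The possible states\<close>

text \<open>The state of a vertex regardless of where the window starts. It differs from
  \<open>state\<close> only on \<open>col_edge\<close>, where \<open>state\<close> takes the row bit
  one grid column later.\<close>

definition vertex_state :: "nat \<times> nat \<Rightarrow> bool \<times> bool \<times> bool \<times> bool \<times> bool" where
  "vertex_state = (\<lambda>(R, C). (even R, even C, hbit R (Suc C), vbit R C, hflip R C))"

text \<open>One representative vertex for each of the 20 possible states.\<close>

definition vertices :: "(nat \<times> nat) list" where
  "vertices = [(0, 0), (0, 1), (0, 2), (1, 0), (1, 1), (1, 2), (1, 3), (1, 5), (2, 0), (2, 1), (2, 2),
     (2, 5), (3, 0), (3, 1), (3, 5), (4, 1), (5, 0), (5, 1), (7, 1), (11, 1)]"

text \<open>For \<open>R\<close> even \<open>hflip\<close> fails, and for \<open>R\<close> odd and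
  \<open>C\<close> even it holds; these are the only relations, leaving
  \<open>8 + 4 + 8 = 20\<close> states.\<close>

definition states :: "(bool \<times> bool \<times> bool \<times> bool \<times> bool) set" where
  "states = {(x, y, h, v, d). (x \<longrightarrow> \<not> d) \<and> (\<not> x \<and> y \<longrightarrow> d)}"

lemma vertex_state_in_states: "vertex_state p \<in> states"
  by (cases p) (auto simp: vertex_state_def states_def hflip_even_row hflip_odd_row)

lemma vertices_realize:
  "\<forall>x y h v d. (x \<longrightarrow> \<not> d) \<and> (\<not> x \<and> y \<longrightarrow> d) \<longrightarrow> list_ex (\<lambda>p. vertex_state p = (x, y, h, v, d)) vertices"
  by code_simp

lemma states_eq: "states = set (map vertex_state vertices)"
proof
  show "states \<subseteq> set (map vertex_state vertices)"
  proof
    fix s assume "s \<in> states"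
    moreover obtain x y h v d where s: "s = (x, y, h, v, d)" by (cases s)
    ultimately have "(x \<longrightarrow> \<not> d) \<and> (\<not> x \<and> y \<longrightarrow> d)" by (simp add: states_def)
    then obtain p where "p \<in> set vertices" "vertex_state p = (x, y, h, v, d)"
      using vertices_realize unfolding list_ex_iff by blast
    then show "s \<in> set (map vertex_state vertices)"
      unfolding s set_map by (metis image_eqI)
  qed
  show "set (map vertex_state vertices) \<subseteq> states"
    using vertex_state_in_states by auto
qed

text \<open>This is \<open>view\<close> with the visibility conditions as plain Booleans, which
  makes the number of distinguishable states computable.\<close>

fun mask :: "bool \<Rightarrow> bool \<Rightarrow> bool \<Rightarrow> bool \<Rightarrow> bool \<Rightarrow> bool \<times> bool \<times> bool \<times> bool \<times> bool \<Rightarrow>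
    bool \<times> bool \<times> bool \<times> bool \<times> bool" where
  "mask p q r s u (x, y, h, v, d) = (p \<and> x \<noteq> y, q \<and> x, r \<and> h, s \<and> v, u \<and> d)"

text \<open>The arguments are half, full and crossing for the row residue, then half, full and edge
  for the column residue.\<close>

definition view_count :: "bool \<Rightarrow> bool \<Rightarrow> bool \<Rightarrow> bool \<Rightarrow> bool \<Rightarrow> bool \<Rightarrow> nat" where
  "view_count hr fr cr hc fc ec = length (remdups (map (mask hc hr fc fr (fc \<and> (cr \<or> fr \<and> \<not> ec)))
     (map vertex_state vertices)))"

text \<open>The four row types that occur, each with the four column types that occur.\<close>

lemma view_count_table:
  "view_count True False False True False False = 4"
  "view_count True False False True True True = 8"
  "view_count True False False True True False = 8"
  "view_count True False False False True False = 4"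
  "view_count True True False True False False = 8"
  "view_count True True False True True True = 16"
  "view_count True True False True True False = 20"
  "view_count True True False False True False = 12"
  "view_count True True True True False False = 8"
  "view_count True True True True True True = 20"
  "view_count True True True True True False = 20"
  "view_count True True True False True False = 12"
  "view_count False True True True False False = 4"
  "view_count False True True True True True = 16"
  "view_count False True True True True False = 16"
  "view_count False True True False True False = 8"
  by code_simp+

section \<open>A window determines the residues of its position\<close>

lemma same_windowD:
  assumes "same_window n (r, c) (r', c')" "a < n" "b < n"
  shows "hbit (r + a) (Suc (c + b)) = hbit (r' + a) (Suc (c' + b))"
    and "vbit (r + a) (Suc (c + b)) = vbit (r' + a) (Suc (c' + b))"
  using assms by (auto simp: same_window_def)

text \<open>In an even row the bit changes at every step. In an odd row the runs have length at
  least 2, so two successive changes are impossible.\<close>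

lemma even_row_iff: "even r \<longleftrightarrow> vbit r (Suc (Suc j)) \<noteq> vbit r (Suc j) \<and> vbit r (Suc (Suc (Suc j))) \<noteq> vbit r (Suc (Suc j))"
proof (cases "even r")
  case True
  then show ?thesis using vbit_Suc_col[of r] hflip_even_row[of r] by simp
next
  case False
  have "hflip r (Suc j) \<or> hflip r (Suc (Suc j))"
    using hflip_odd_row[OF False] by simp
  then show ?thesis using False vbit_Suc_col[of r] by auto
qed

lemma same_window_even_row:
  assumes "same_window n (r, c) (r', c')" "3 \<le> n"
  shows "even r = even r'"
  using same_windowD(2)[OF assms(1), of 0] assms(2) even_row_iff[of r c] even_row_iff[of r' c']
  by (simp add: numeral_eq_Suc) (metis Suc_le_lessD add_Suc_right add_0_right le_SucI less_Suc_eq_le Suc_le_eq)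

text \<open>For \<open>c\<close> even and \<open>c'\<close> odd, compare the column flips below an
  odd row. They always occur at even grid columns; matching them at two adjacent offsets forces both
  rows to be 3 modulo 4. The next rows are multiples of 4, where the row bit is the parity of the
  column, and these parities differ.\<close>

lemma same_window_odd_col:
  assumes same: "same_window n (r, c) (r', c')" and n: "3 \<le> n" and c: "even c"
  shows "even c'"
proof (rule ccontr)
  assume c': "odd c'"
  \<comment> \<open>With \<open>a < 2\<close> the row below is still in the window, since
    \<open>n \<ge> 3\<close>.\<close>
  obtain a where a: "a < 2" "odd (r + a)"
    by (cases "even r") (auto intro: that[of 0] that[of 1])
  have "even r = even r'" using same n by (rule same_window_even_row)
  with a have a': "odd (r' + a)" by auto
  have flip: "hflip (r + a) (c + b) = hflip (r' + a) (c' + b)" if "b < 3" for b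
    using same_windowD(1)[OF same, of a b] same_windowD(1)[OF same, of "Suc a" b] a that n
      hbit_Suc_row[of "r + a" "c + b"] hbit_Suc_row[of "r' + a" "c' + b"] by (simp, blast)
  have "hflip ((r + a) div 2) ((c + 1) div 2)"
    using flip[of 1] hflip_odd_row[OF a(2), of "c + 1"] hflip_odd_row[OF a', of "c' + 1"] c c' by simp
  moreover have "hflip ((r' + a) div 2) (c' div 2)"
    using flip[of 0] hflip_odd_row[OF a(2), of c] hflip_odd_row[OF a', of c'] c c' by simp
  ultimately have "odd ((r + a) div 2)" "odd ((r' + a) div 2)"
    using hflip_even_row by blast+
  with a(2) a' have "even (Suc (r + a) div 2)" "even (Suc (r' + a) div 2)"
    by presburger+
  moreover have "vbit (Suc (r + a)) (Suc c) = vbit (Suc (r' + a)) (Suc c')"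
    using same_windowD(2)[OF same, of "Suc a" 0] a n by simp
  ultimately show False
    using vbit_rec[of "Suc (r + a)" "Suc c"] vbit_rec[of "Suc (r' + a)" "Suc c'"] a(2) a' c c' by simp
qed

lemma same_window_sym: "same_window n p q \<Longrightarrow> same_window n q p"
  by (auto simp: same_window_def)

lemma ex_add_mod_eq:
  fixes x y m :: nat
  assumes "y < m"
  shows "\<exists>a<m. (x + a) mod m = y"
proof (intro exI conjI)
  show "(y + (m - x mod m)) mod m < m" using assms by simp
  have "(x + (y + (m - x mod m)) mod m) mod m = (x mod m + (y + (m - x mod m))) mod m"
    by (simp add: mod_add_right_eq mod_add_left_eq)
  also have "x mod m + (y + (m - x mod m)) = y + m"
    using mod_less_divisor[of m x] assms by linarith
  finally show "(x + (y + (m - x mod m)) mod m) mod m = y" using assms by simp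
qed

lemma mod_double_eqI:
  fixes x y a m :: nat
  assumes "x mod m = y mod m" "odd ((x + a) div m) = odd ((y + a) div m)"
  shows "x mod (2 * m) = y mod (2 * m)"
proof -
  have "(x + a) mod m = (y + a) mod m" using assms(1) by (rule mod_add_cong)
  moreover have "(x + a) div m mod 2 = (y + a) div m mod 2"
    using assms(2) by (simp add: mod_2_eq_odd)
  ultimately have "(x + a) mod (m * 2) = (y + a) mod (m * 2)" by (simp only: mod_mult2_eq)
  then have "[x + a = y + a] (mod m * 2)" by (simp add: cong_def)
  then have "[x = y] (mod m * 2)" by (simp only: cong_add_rcancel_nat)
  then show ?thesis by (simp add: cong_def mult.commute)
qed

text \<open>With residues known modulo \<open>2^(u+1) \<le> n\<close>, both windows have a row and a
  column of valuation \<open>u\<close> at the same offsets. The row bit gives the next bit of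
  \<open>r\<close>, as the column parity it involves is known; then the column bit gives the next
  bit of \<open>c\<close>.\<close>

lemma same_window_mod_eq:
  assumes same: "same_window n (r, c) (r', c')" and "3 \<le> n" "2 ^ u \<le> n"
  shows "r mod (2 * 2 ^ u) = r' mod (2 * 2 ^ u) \<and> c mod (2 * 2 ^ u) = c' mod (2 * 2 ^ u)"
  using assms(3)
proof (induction u)
  case 0
  have "even r = even r'" "even c = even c'"
    using same_window_even_row[OF same assms(2)] same_window_odd_col[OF same assms(2)]
      same_window_odd_col[OF same_window_sym[OF same] assms(2)] by blast+
  then show ?case by (simp add: mod_2_eq_odd)
next
  case (Suc u)
  let ?m = "2 * 2 ^ u :: nat"
  have IH: "r mod ?m = r' mod ?m" "c mod ?m = c' mod ?m" using Suc by auto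
  have n: "?m \<le> n" "0 < n" using Suc.prems assms(2) by simp_all
  have lt: "(2::nat) ^ u < ?m" by simp
  from ex_add_mod_eq[OF lt, of "r + 1"] obtain a where a: "a < ?m" "(r + a + 1) mod ?m = 2 ^ u"
    by (auto simp: ac_simps)
  from ex_add_mod_eq[OF lt, of "c + 1"] obtain b where b: "b < ?m" "(c + b + 1) mod ?m = 2 ^ u"
    by (auto simp: ac_simps)
  have a': "(r' + a + 1) mod ?m = 2 ^ u"
    using a(2) mod_add_cong[OF IH(1), of "a + 1"] by (simp add: add.assoc)
  have b': "(c' + b + 1) mod ?m = 2 ^ u"
    using b(2) mod_add_cong[OF IH(2), of "b + 1"] by (simp add: add.assoc)
  have "vbit (r + a) (c + 1) = vbit (r' + a) (c' + 1)"
    using same_windowD(2)[OF same, of a 0] a(1) n by simp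
  moreover have "odd ((c + 1) div 2 ^ u) = odd ((c' + 1) div 2 ^ u)"
    using mod_add_cong[OF IH(2)] by (rule parity_div_cong)
  ultimately have "odd ((r + a) div ?m) = odd ((r' + a) div ?m)"
    unfolding vbit_half[OF a(2)] vbit_half[OF a'] by blast
  with IH(1) have r: "r mod (2 * ?m) = r' mod (2 * ?m)" by (rule mod_double_eqI)
  have "hbit r (c + b + 1) = hbit r' (c' + b + 1)"
    using same_windowD(1)[OF same, of 0 b] b(1) n by simp
  moreover have "odd (r div ?m) = odd (r' div ?m)"
    using r by (rule parity_div_cong)
  ultimately have "odd ((c + (b + 1)) div ?m) = odd ((c' + (b + 1)) div ?m)"
    unfolding hbit_half[OF b(2)] hbit_half[OF b'] by (auto simp: add.assoc)
  with IH(2) have "c mod (2 * ?m) = c' mod (2 * ?m)" by (rule mod_double_eqI)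
  with r show ?case by simp
qed

section \<open>Counting\<close>

lemma card_range_eq:
  assumes "\<And>p q. f p = f q \<longleftrightarrow> g p = g q"
  shows "card (range f) = card (range g)"
proof -
  have "f (inv_into UNIV f (f p)) = f p" "g (inv_into UNIV g (g p)) = g p" for p
    by (simp_all add: f_inv_into_f)
  then have "g (inv_into UNIV f (f p)) = g p" "f (inv_into UNIV g (g p)) = f p" for p
    using assms by blast+
  then have "bij_betw (\<lambda>y. g (inv_into UNIV f y)) (range f) (range g)"
    by (intro bij_betw_byWitness[where f' = "\<lambda>z. f (inv_into UNIV g z)"]) (auto simp: f_inv_into_f)
  then show ?thesis by (rule bij_betw_same_card)
qed

section \<open>Summation over the residues\<close>

lemma sum_split:
  fixes f :: "nat \<Rightarrow> nat"
  assumes "a \<le> b" "b \<le> c" "c \<le> d" "d \<le> e"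
  shows "sum f {..<e} = sum f {0..<a} + sum f {a..<b} + sum f {b..<c} + sum f {c..<d} + sum f {d..<e}"
  using assms by (simp add: lessThan_atLeast0 sum.atLeastLessThan_concat)

text \<open>
  For \<open>k = 2^t\<close> the three arguments of \<open>G\<close> are \<open>sees_half\<close>, \<open>sees_full\<close> and \<open>row_crossing\<close>
  (below: \<open>col_edge\<close>).
\<close>

lemma sum_row_types:
  fixes G :: "bool \<Rightarrow> bool \<Rightarrow> bool \<Rightarrow> nat"
  assumes "k < n" "n \<le> 2 * k"
  shows "(\<Sum>\<rho><2 * k. G (\<rho> < k \<or> 2 * k + k \<le> \<rho> + n) (2 * k \<le> \<rho> + n) (2 * k < \<rho> + n)) =
    (2 * k - n) * G True False False + G True True False + (2 * n - 2 * k - 1) * G True True True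
    + (2 * k - n) * G False True True"
proof -
  let ?G = "\<lambda>\<rho>. G (\<rho> < k \<or> 2 * k + k \<le> \<rho> + n) (2 * k \<le> \<rho> + n) (2 * k < \<rho> + n)"
  have G: "?G \<rho> = G x y z" if "\<rho> < k \<or> 2 * k + k \<le> \<rho> + n \<longleftrightarrow> x" "2 * k \<le> \<rho> + n \<longleftrightarrow> y" "2 * k < \<rho> + n \<longleftrightarrow> z"
    for \<rho> x y z
    unfolding that ..
  \<comment> \<open>The cut points are where one of the three conditions changes; the third and the
    fifth piece have the same type.\<close>
  have "sum ?G {..<2 * k} = sum ?G {0..<2 * k - n} + sum ?G {2 * k - n..<Suc (2 * k - n)}
      + sum ?G {Suc (2 * k - n)..<k} + sum ?G {k..<2 * k + k - n} + sum ?G {2 * k + k - n..<2 * k}"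
    using assms by (intro sum_split) linarith+
  also have "sum ?G {0..<2 * k - n} = (\<Sum>\<rho>\<in>{0..<2 * k - n}. G True False False)"
    using assms by (intro sum.cong refl G) auto
  also have "sum ?G {2 * k - n..<Suc (2 * k - n)} = (\<Sum>\<rho>\<in>{2 * k - n..<Suc (2 * k - n)}. G True True False)"
    using assms by (intro sum.cong refl G) auto
  also have "sum ?G {Suc (2 * k - n)..<k} = (\<Sum>\<rho>\<in>{Suc (2 * k - n)..<k}. G True True True)"
    using assms by (intro sum.cong refl G) auto
  also have "sum ?G {k..<2 * k + k - n} = (\<Sum>\<rho>\<in>{k..<2 * k + k - n}. G False True True)"
    using assms by (intro sum.cong refl G) auto
  also have "sum ?G {2 * k + k - n..<2 * k} = (\<Sum>\<rho>\<in>{2 * k + k - n..<2 * k}. G True True True)"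
    using assms by (intro sum.cong refl G) auto
  finally have "sum ?G {..<2 * k} = (2 * k - n) * G True False False + G True True False
      + ((k - Suc (2 * k - n)) + (2 * k - (2 * k + k - n))) * G True True True
      + (2 * k + k - n - k) * G False True True"
    by (simp add: distrib_right)
  moreover have "(k - Suc (2 * k - n)) + (2 * k - (2 * k + k - n)) = 2 * n - 2 * k - 1"
    "2 * k + k - n - k = 2 * k - n"
    using assms by linarith+
  ultimately show ?thesis by (simp only:)
qed

lemma sum_col_types:
  fixes G :: "bool \<Rightarrow> bool \<Rightarrow> bool \<Rightarrow> nat"
  assumes "k < n" "n \<le> 2 * k"
  shows "(\<Sum>\<gamma><2 * k. G (\<gamma> < k \<or> 2 * k + k \<le> \<gamma> + n) (2 * k \<le> \<gamma> + n) (\<gamma> + 1 = 2 * k)) =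
    (2 * k - n) * G True False False + G True True True + (2 * n - 2 * k - 1) * G True True False
    + (2 * k - n) * G False True False"
proof -
  let ?G = "\<lambda>\<gamma>. G (\<gamma> < k \<or> 2 * k + k \<le> \<gamma> + n) (2 * k \<le> \<gamma> + n) (\<gamma> + 1 = 2 * k)"
  have G: "?G \<gamma> = G x y z" if "\<gamma> < k \<or> 2 * k + k \<le> \<gamma> + n \<longleftrightarrow> x" "2 * k \<le> \<gamma> + n \<longleftrightarrow> y" "\<gamma> + 1 = 2 * k \<longleftrightarrow> z"
    for \<gamma> x y z
    unfolding that ..
  \<comment> \<open>The last residue is split off as the edge; the second and the fourth piece have
    the same type.\<close>
  have "sum ?G {..<2 * k} = sum ?G {0..<2 * k - n} + sum ?G {2 * k - n..<k}
      + sum ?G {k..<2 * k + k - n} + sum ?G {2 * k + k - n..<2 * k - 1} + sum ?G {2 * k - 1..<2 * k}"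
    using assms by (intro sum_split) linarith+
  also have "sum ?G {0..<2 * k - n} = (\<Sum>\<gamma>\<in>{0..<2 * k - n}. G True False False)"
    using assms by (intro sum.cong refl G) auto
  also have "sum ?G {2 * k - n..<k} = (\<Sum>\<gamma>\<in>{2 * k - n..<k}. G True True False)"
    using assms by (intro sum.cong refl G) auto
  also have "sum ?G {k..<2 * k + k - n} = (\<Sum>\<gamma>\<in>{k..<2 * k + k - n}. G False True False)"
    using assms by (intro sum.cong refl G) auto
  also have "sum ?G {2 * k + k - n..<2 * k - 1} = (\<Sum>\<gamma>\<in>{2 * k + k - n..<2 * k - 1}. G True True False)"
    using assms by (intro sum.cong refl G) auto
  also have "sum ?G {2 * k - 1..<2 * k} = (\<Sum>\<gamma>\<in>{2 * k - 1..<2 * k}. G True True True)"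
    using assms by (intro sum.cong refl G) auto
  finally have "sum ?G {..<2 * k} = (2 * k - n) * G True False False
      + (2 * k - (2 * k - 1)) * G True True True
      + ((k - (2 * k - n)) + (2 * k - 1 - (2 * k + k - n))) * G True True False
      + (2 * k + k - n - k) * G False True False"
    by (simp add: distrib_right)
  moreover have "(k - (2 * k - n)) + (2 * k - 1 - (2 * k + k - n)) = 2 * n - 2 * k - 1"
    "2 * k - (2 * k - 1) = 1" "2 * k + k - n - k = 2 * k - n"
    using assms by linarith+
  ultimately show ?thesis by (simp only: mult_1)
qed

context window_scale
begin

lemma view_eq_mask: "view \<rho> \<gamma> = mask (sees_half \<gamma>) (sees_half \<rho>) (sees_full \<gamma>) (sees_full \<rho>)
    (sees_full \<gamma> \<and> (row_crossing \<rho> \<or> sees_full \<rho> \<and> \<not> col_edge \<gamma>))"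
  by (rule ext) auto

lemma card_view:
  "card (view \<rho> \<gamma> ` states) = view_count (sees_half \<rho>) (sees_full \<rho>) (row_crossing \<rho>)
     (sees_half \<gamma>) (sees_full \<gamma>) (col_edge \<gamma>)"
  unfolding view_eq_mask view_count_def states_eq by (simp only: set_map[symmetric] card_set)

lemma position_div_mod:
  assumes "\<gamma> < M"
  shows "(M * C + \<gamma> + 1) div M = (if col_edge \<gamma> then Suc C else C)"
  using assms by (auto simp: col_edge_def intro!: div_nat_eqI)

lemma state_in_states: "state p \<in> states"
  by (auto simp: state_def Let_def states_def hflip_even_row hflip_odd_row)

lemma state_realized:
  assumes "\<rho> < M" "\<gamma> < M" "s \<in> states"
  shows "\<exists>(R, C) \<in> set vertices. state (M * R + \<rho>, M * C + \<gamma>) = s"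
proof -
  obtain x y h v d where s: "s = (x, y, h, v, d)" by (cases s)
  \<comment> \<open>On \<open>col_edge\<close> the state contains \<open>vbit R (Suc C)\<close>;
    solving \<open>vbit_Suc_col\<close> for \<open>vbit R C\<close> gives
    \<open>v = d\<close>.\<close>
  define s' where "s' = (x, y, h, if col_edge \<gamma> then v = d else v, d)"
  have "s' \<in> states" using assms(3) by (auto simp: s s'_def states_def)
  then obtain R C where RC: "(R, C) \<in> set vertices" "vertex_state (R, C) = s'"
    unfolding states_eq by auto
  have "(M * R + \<rho>) div M = R" "(M * C + \<gamma>) div M = C"
    using assms by simp_all
  then have "state (M * R + \<rho>, M * C + \<gamma>) = s"
    using RC(2) unfolding state_def fst_conv snd_conv position_div_mod[OF assms(2)]
    by (auto simp: vertex_state_def s s'_def vbit_Suc_col Let_def)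
  with RC(1) show ?thesis by auto
qed

text \<open>A complete invariant of the window for \<open>n \<ge> 3\<close>. The residues accompany
  the view because they decide which of its components are masked.\<close>

definition key :: "nat \<times> nat \<Rightarrow> (nat \<times> nat) \<times> bool \<times> bool \<times> bool \<times> bool \<times> bool" where
  "key p = ((fst p mod M, snd p mod M), view (fst p mod M) (snd p mod M) (state p))"

lemma range_key: "range key = (SIGMA p : {..<M} \<times> {..<M}. view (fst p) (snd p) ` states)"
proof (intro equalityI subsetI)
  fix k assume "k \<in> range key"
  then show "k \<in> (SIGMA p : {..<M} \<times> {..<M}. view (fst p) (snd p) ` states)"
    using state_in_states mod_M by (auto simp: key_def)
next
  fix k assume "k \<in> (SIGMA p : {..<M} \<times> {..<M}. view (fst p) (snd p) ` states)"
  then obtain \<rho> \<gamma> s where k: "\<rho> < M" "\<gamma> < M" "s \<in> states" "k = ((\<rho>, \<gamma>), view \<rho> \<gamma> s)"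
    by auto
  from state_realized[OF k(1-3)] obtain R C where "state (M * R + \<rho>, M * C + \<gamma>) = s"
    by auto
  with k have "k = key (M * R + \<rho>, M * C + \<gamma>)"
    by (simp add: key_def)
  then show "k \<in> range key" by blast
qed

lemma same_window_iff_key_eq:
  assumes "3 \<le> n"
  shows "same_window n p q \<longleftrightarrow> key p = key q"
proof -
  obtain r c r' c' where pq: "p = (r, c)" "q = (r', c')" by fastforce
  show ?thesis
  proof
    assume same: "same_window n p q"
    with same_window_mod_eq[of n r c r' c' t] lower assms
    have mods: "r mod M = r' mod M" "c mod M = c' mod M" by (simp_all add: pq)
    with same show "key p = key q"
      unfolding pq key_def fst_conv snd_conv using same_window_iff_view_eq[OF mods] by metis
  next
    assume "key p = key q"
    then have mods: "r mod M = r' mod M" "c mod M = c' mod M"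
      and "view (r mod M) (c mod M) (state (r, c)) = view (r' mod M) (c' mod M) (state (r', c'))"
      unfolding pq key_def fst_conv snd_conv prod.inject by blast+
    then show "same_window n p q"
      unfolding pq using same_window_iff_view_eq[OF mods] by metis
  qed
qed

lemma sum_rows:
  fixes G :: "bool \<Rightarrow> bool \<Rightarrow> bool \<Rightarrow> nat"
  shows "(\<Sum>\<rho><M. G (sees_half \<rho>) (sees_full \<rho>) (row_crossing \<rho>)) =
    (M - n) * G True False False + G True True False + (2 * n - M - 1) * G True True True
    + (M - n) * G False True True"
  unfolding sees_half_def sees_full_def row_crossing_def using lower upper by (rule sum_row_types)

lemma sum_cols:
  fixes G :: "bool \<Rightarrow> bool \<Rightarrow> bool \<Rightarrow> nat"
  shows "(\<Sum>\<gamma><M. G (sees_half \<gamma>) (sees_full \<gamma>) (col_edge \<gamma>)) =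
    (M - n) * G True False False + G True True True + (2 * n - M - 1) * G True True False
    + (M - n) * G False True False"
  unfolding sees_half_def sees_full_def col_edge_def using lower upper by (rule sum_col_types)

lemma card_range_key:
  "int (card (range key)) = 12 * int n ^ 2 + 24 * int n * int K - 16 * int K ^ 2 - 4"
proof -
  define G where "G hr fr cr = (M - n) * view_count hr fr cr True False False
      + view_count hr fr cr True True True + (2 * n - M - 1) * view_count hr fr cr True True False
      + (M - n) * view_count hr fr cr False True False" for hr fr cr
  have "finite (view \<rho> \<gamma> ` states)" for \<rho> \<gamma>
    by (simp add: states_eq)
  then have "card (range key) = (\<Sum>p\<in>{..<M} \<times> {..<M}. card (view (fst p) (snd p) ` states))"
    unfolding range_key by (intro card_SigmaI) auto
  also have "\<dots> = (\<Sum>\<rho><M. \<Sum>\<gamma><M. card (view \<rho> \<gamma> ` states))"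
    by (simp add: sum.cartesian_product case_prod_unfold)
  also have "\<dots> = (\<Sum>\<rho><M. G (sees_half \<rho>) (sees_full \<rho>) (row_crossing \<rho>))"
    unfolding card_view G_def by (subst sum_cols) (rule refl)
  also have "\<dots> = 20 * (M - n)\<^sup>2 + 44 * (M - n) * (2 * n - M - 1 + 1)
      + 20 * (2 * n - M - 1)\<^sup>2 + 40 * (2 * n - M - 1) + 16"
  proof -
    \<comment> \<open>Naming the truncated differences turns the claim into a polynomial identity in
      \<open>x\<close> and \<open>y\<close>.\<close>
    obtain x y where "M - n = x" "2 * n - M - 1 = y" by blast
    then show ?thesis
      unfolding sum_rows unfolding G_def view_count_table by (simp add: power2_eq_square algebra_simps)
  qed
  finally have "int (card (range key)) = 20 * (int (M - n))\<^sup>2 + 44 * int (M - n) * (int (2 * n - M - 1) + 1)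
      + 20 * (int (2 * n - M - 1))\<^sup>2 + 40 * int (2 * n - M - 1) + 16"
    by (simp add: distrib_left)
  \<comment> \<open>Both differences are genuine because \<open>K < n \<le> M\<close>, so the
    polynomial can be expanded over the integers.\<close>
  moreover have "int (M - n) = 2 * int K - int n" "int (2 * n - M - 1) = 2 * int n - 2 * int K - 1"
    using lower upper by (simp_all add: of_nat_diff)
  ultimately show ?thesis
    by (simp only:) (simp add: power2_eq_square algebra_simps)
qed

end

section \<open>The windows of size 2\<close>

definition small_window :: "nat \<times> nat \<Rightarrow> bool list" where
  "small_window = (\<lambda>(r, c). [hbit r (c + 1), hbit r (c + 2), hbit (r + 1) (c + 1), hbit (r + 1) (c + 2),
     vbit r (c + 1), vbit r (c + 2), vbit (r + 1) (c + 1), vbit (r + 1) (c + 2)])"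

definition small_positions :: "(nat \<times> nat) list" where
  "small_positions = concat (map (\<lambda>(R, C).
     [(2 * R, 2 * C), (2 * R, 2 * C + 1), (2 * R + 1, 2 * C), (2 * R + 1, 2 * C + 1)]) vertices)"

lemma small_window_eq_iff: "small_window p = small_window q \<longleftrightarrow> same_window 2 p q"
  by (auto simp: small_window_def same_window_def less_2_cases_iff case_prod_unfold)

text \<open>Windows of size 2 do not determine their residues, so they are enumerated directly. For
  equal residues equal views still give equal windows, and the listed vertices realize every state
  at each of the four residues modulo 2.\<close>

lemma range_small_window: "range small_window = small_window ` set small_positions"
proof (intro equalityI subsetI)
  interpret window_scale 0 2 by unfold_locales simp_all
  fix w assume "w \<in> range small_window"
  then obtain r c where w: "w = small_window (r, c)" by auto
  from state_realized[of "r mod M" "c mod M" "state (r, c)"] obtain R C where RC: "(R, C) \<in> set vertices"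
    "state (2 * R + r mod 2, 2 * C + c mod 2) = state (r, c)"
    using state_in_states by auto
  have "same_window 2 (r, c) (2 * R + r mod 2, 2 * C + c mod 2)"
    using same_window_iff_view_eq[of r "2 * R + r mod 2" c "2 * C + c mod 2"] RC(2) by simp
  moreover have "(2 * R + r mod 2, 2 * C + c mod 2) \<in> set small_positions"
    using RC(1) by (auto simp: small_positions_def mod_2_eq_odd intro!: bexI[of _ "(R, C)"])
  ultimately show "w \<in> small_window ` set small_positions"
    unfolding w by (metis small_window_eq_iff image_eqI)
qed auto

lemma length_small_windows: "length (remdups (map small_window small_positions)) = 68"
  by code_simp

section \<open>The numbers of patterns\<close>

lemma window_eq_iff: "window n r c = window n r' c' \<longleftrightarrow> same_window n (r, c) (r', c')"
proof
  assume eq: "window n r c = window n r' c'"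
  have "digit_at (r + a) (c + 1 + b) = digit_at (r' + a) (c' + 1 + b)" if "a < n" "b < n" for a b
    using arg_cong[OF eq, of "\<lambda>X. X $$ (a, b)"] that by (simp add: window_def)
  then show "same_window n (r, c) (r', c')"
    by (simp add: same_window_def digit_at_def)
next
  assume "same_window n (r, c) (r', c')"
  then show "window n r c = window n r' c'"
    by (auto simp: window_def same_window_def digit_at_def intro!: eq_matI)
qed

lemma card_S_patterns:
  assumes "\<And>p q. same_window n p q \<longleftrightarrow> g p = g q"
  shows "card (S_patterns n n) = card (range g)"
proof -
  have "S_patterns n n = range (\<lambda>p. window n (fst p) (snd p))"
    unfolding S_patterns_eq by (auto simp: image_iff split_paired_Ex) blast
  also have "card \<dots> = card (range g)"
    by (rule card_range_eq) (simp only: window_eq_iff prod.collapse assms)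
  finally show ?thesis .
qed

lemma card_S_patterns_1: "card (S_patterns 1 1) = 4"
proof -
  let ?g = "\<lambda>p. (hbit (fst p) (snd p + 1), vbit (fst p) (snd p + 1))"
  have vals: "?g (0, 0) = (False, True)" "?g (0, 1) = (False, False)" "?g (0, 2) = (True, True)"
    "?g (2, 0) = (True, False)"
    by code_simp+
  have "UNIV = ?g ` {(0, 0), (0, 1), (0, 2), (2, 0)}"
    unfolding image_insert image_empty vals by auto
  then have "range ?g = UNIV" by blast
  moreover have "card (S_patterns 1 1) = card (range ?g)"
    by (rule card_S_patterns) (simp add: same_window_def)
  ultimately show ?thesis by (simp add: card_UNIV_bool flip: UNIV_Times_UNIV)
qed

lemma card_S_patterns_2: "card (S_patterns 2 2) = 68"
proof -
  have "card (S_patterns 2 2) = card (range small_window)"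
    by (rule card_S_patterns) (simp add: small_window_eq_iff)
  also have "range small_window = set (map small_window small_positions)"
    by (simp add: range_small_window)
  also have "card \<dots> = length (remdups (map small_window small_positions))"
    by (rule card_set)
  also have "\<dots> = 68" by (rule length_small_windows)
  finally show ?thesis .
qed

lemma card_S_patterns_ge_3:
  assumes "3 \<le> n" "2 ^ t < n" "n \<le> 2 * 2 ^ t"
  shows "int (card (S_patterns n n)) = 12 * int n ^ 2 + 24 * int n * 2 ^ t - 16 * 4 ^ t - 4"
proof -
  interpret window_scale t n using assms by unfold_locales
  have "card (S_patterns n n) = card (range key)"
    using same_window_iff_key_eq[OF assms(1)] by (rule card_S_patterns)
  moreover have "(int K)\<^sup>2 = 4 ^ t"
    by (simp add: power2_eq_square flip: power_mult_distrib)
  ultimately show ?thesis using card_range_key by simp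
qed

theorem theorem1:
  shows "card (S_patterns 1 1) = 4 \<and>
    card (S_patterns 2 2) = 68 \<and>
    (\<forall>n\<ge>3. let \<alpha> = nat \<lfloor>log 2 (real n - 1)\<rfloor> in
       int (card (S_patterns n n)) = 12 * int n ^ 2 + 24 * int n * 2 ^ \<alpha> - 16 * 4 ^ \<alpha> - 4)"
proof (intro conjI allI impI)
  fix n :: nat assume n: "3 \<le> n"
  then have "1 \<le> n - 1" by simp
  from ex_power_ivl1[OF order_refl this]
  obtain t where t: "2 ^ t \<le> n - 1" "n - 1 < 2 ^ (t + 1)" by blast
  then have "\<lfloor>log (real 2) (real (n - 1))\<rfloor> = int t"
    by (intro floor_log_nat_eq_if) simp_all
  with n have "nat \<lfloor>log 2 (real n - 1)\<rfloor> = t"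
    by (simp add: of_nat_diff)
  moreover have "2 ^ t < n" "n \<le> 2 * 2 ^ t" using t n by simp_all
  ultimately show "let \<alpha> = nat \<lfloor>log 2 (real n - 1)\<rfloor> in
       int (card (S_patterns n n)) = 12 * int n ^ 2 + 24 * int n * 2 ^ \<alpha> - 16 * 4 ^ \<alpha> - 4"
    using card_S_patterns_ge_3[OF n] by (simp add: Let_def)
qed (fact card_S_patterns_1 card_S_patterns_2)+

end
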